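(* Set $\hbar=1$. Let $\Sigma(t)=\nu(t)\mathbb 1_2$ be a continuously differentiable radial compression trajectory in the region $\nu>1/2$ with $\nu(t)\downarrow\frac12$, and suppose that, sufficiently close to the boundary, $$0<v_0\le-\dot\nu(t)\le v_1<\infty .$$ Define the Bures and Bures--Wasserstein kinetic densities by $K_{\rm B}=g^{\rm B}_{\nu\nu}\dot\nu^2$ and $K_{\rm BW}=g_{\rm BW}(\dot\Sigma,\dot\Sigma)$. Then $$K_{\rm B}=\frac{\dot\nu^2}{4\left(\nu^2-\frac14\right)}\longrightarrow\infty\qquad\left(\nu\downarrow\tfrac12\right),$$ whereas $$K_{\rm BW}=\frac{\dot\nu^2}{2\nu}$$ remains bounded. Moreover, over the final segment of the trajectory approaching the boundary, the integrated Bures kinetic action diverges while the integrated Bures--Wasserstein kinetic action remains finite: $$\int K_{\rm B}\,dt=\infty,\qquad\int K_{\rm BW}\,dt<\infty .$$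
   Context: The radial one-mode Bures coefficient (units $\hbar=1$) is $g^{\rm B}_{\nu\nu}=\frac{1}{4(\nu^2-\frac14)}$ for $\nu>1/2$. The Bures--Wasserstein metric on real symmetric positive definite matrices is $g_{{\rm BW},\Sigma}(X,Y)=\frac12\operatorname{Tr}[\mathcal L_\Sigma(X)Y]$, where $\mathcal L_\Sigma(X)$ is the symmetric solution of $\Sigma\mathcal L_\Sigma(X)+\mathcal L_\Sigma(X)\Sigma=X$. The final segment is a final portion of the time interval, ending when the boundary $\nu=1/2$ is reached, on which the stated rate bounds hold; $v_0,v_1$ are constants and $\dot\nu=d\nu/dt$. *)

theory Defs
  imports "HOL-Analysis.Analysis"
begin

text \<open>Coefficient of \<open>d\<nu>\<^sup>2\<close> in the one-mode Bures metric along the radial family, with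
  \<open>\<hbar> = 1\<close>; meaningful for \<open>\<nu> > 1/2\<close>.\<close>

definition bures_radial_coeff :: "real \<Rightarrow> real" where
  "bures_radial_coeff x = 1 / (4 * (x\<^sup>2 - 1 / 4))"

text \<open>The symmetric solution of the Lyapunov equation. For symmetric \<open>X\<close> and symmetric positive
  definite \<open>\<Sigma>\<close> it exists and is unique; for other arguments the value may be unspecified.\<close>

definition lyapunov :: "real^'n^'n \<Rightarrow> real^'n^'n \<Rightarrow> real^'n^'n" where
  "lyapunov \<Sigma> X = (THE L. transpose L = L \<and> \<Sigma> ** L + L ** \<Sigma> = X)"

definition bw_metric :: "real^'n^'n \<Rightarrow> real^'n^'n \<Rightarrow> real^'n^'n \<Rightarrow> real" where
  "bw_metric \<Sigma> X Y = 1 / 2 * trace (lyapunov \<Sigma> X ** Y)"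

definition radial_covariance :: "(real \<Rightarrow> real) \<Rightarrow> real \<Rightarrow> real^2^2" where
  "radial_covariance \<nu> t = \<nu> t *\<^sub>R mat 1"

definition bures_kinetic :: "(real \<Rightarrow> real) \<Rightarrow> real \<Rightarrow> real" where
  "bures_kinetic \<nu> t = bures_radial_coeff (\<nu> t) * (deriv \<nu> t)\<^sup>2"

definition bw_kinetic :: "(real \<Rightarrow> real^'n^'n) \<Rightarrow> real \<Rightarrow> real" where
  "bw_kinetic \<Sigma> t =
     bw_metric (\<Sigma> t) (vector_derivative \<Sigma> (at t)) (vector_derivative \<Sigma> (at t))"

end

theory Submission
  imports Defs "HOL-Real_Asymp.Real_Asymp"
begin

text \<open>Near the boundary \<open>\<nu>\<^sup>2 - 1/4 = (\<nu> - 1/2)(\<nu> + 1/2)\<close> is at most a constant times \<open>T - t\<close>, because the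
  compression rate is at most \<open>v\<^sub>1\<close>; as the rate is also at least \<open>v\<^sub>0\<close>, the Bures density dominates
  a multiple of \<open>1 / (T - t)\<close>, whose integral diverges logarithmically. The Lyapunov operator of
  a scalar matrix \<open>c\<close> is division by \<open>2c\<close>, so the Bures--Wasserstein density has no
  singularity at \<open>\<nu> = 1/2\<close> and is at most \<open>v\<^sub>1\<^sup>2\<close>.\<close>

text \<open>A scalar matrix commutes with every \<open>L\<close>, so the Lyapunov equation collapses
  to \<open>(2 * c) *\<^sub>R L = X\<close>, which has exactly one solution. Symmetry of
  \<open>X\<close> passes to that solution, as the definite description demands.\<close>

lemma lyapunov_scalar:
  fixes X :: "real^'n^'n"
  assumes "c > 0" and "transpose X = X"
  shows "lyapunov (c *\<^sub>R mat 1) X = (1 / (2 * c)) *\<^sub>R X"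
proof -
  have lhs: "(c *\<^sub>R mat 1) ** L + L ** (c *\<^sub>R mat 1) = (2 * c) *\<^sub>R L" for L :: "real^'n^'n"
    unfolding mult_2 scaleR_left_distrib
    by (simp add: matrix_scalar_ac flip: scalar_matrix_assoc)
  show ?thesis
    unfolding lyapunov_def lhs
  proof (rule the_equality)
    show "transpose ((1 / (2 * c)) *\<^sub>R X) = (1 / (2 * c)) *\<^sub>R X \<and>
        (2 * c) *\<^sub>R ((1 / (2 * c)) *\<^sub>R X) = X"
      using assms by (simp add: transpose_scalar)
  next
    fix L :: "real^'n^'n"
    assume "transpose L = L \<and> (2 * c) *\<^sub>R L = X"
    then show "L = (1 / (2 * c)) *\<^sub>R X"
      using assms(1) by auto
  qed
qed

text \<open>The dimension enters as the trace of the identity; in the two-by-two case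
  \<open>2 / (4 * c)\<close> becomes the factor \<open>1 / (2 * c)\<close> of the radial
  density.\<close>

lemma bw_metric_scalar:
  assumes "c > 0"
  shows "bw_metric (c *\<^sub>R mat 1) (d *\<^sub>R mat 1) (d *\<^sub>R mat 1 :: real^'n^'n) =
    real CARD('n) * d\<^sup>2 / (4 * c)"
proof -
  have "transpose (d *\<^sub>R mat 1 :: real^'n^'n) = d *\<^sub>R mat 1"
    by (simp add: transpose_scalar transpose_mat)
  then have "bw_metric (c *\<^sub>R mat 1) (d *\<^sub>R mat 1) (d *\<^sub>R mat 1 :: real^'n^'n) =
      1 / 2 * trace ((d\<^sup>2 / (2 * c)) *\<^sub>R (mat 1 :: real^'n^'n))"
    unfolding bw_metric_def using assms
    by (simp add: lyapunov_scalar matrix_scalar_ac power2_eq_square flip: scalar_matrix_assoc)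
  also have "\<dots> = real CARD('n) * d\<^sup>2 / (4 * c)"
    by (simp add: trace_def mat_def)
  finally show ?thesis .
qed

lemma bw_kinetic_radial:
  assumes "\<nu> differentiable at t" and "\<nu> t > 0"
  shows "bw_kinetic (radial_covariance \<nu>) t = (deriv \<nu> t)\<^sup>2 / (2 * \<nu> t)"
proof -
  have "(\<nu> has_vector_derivative deriv \<nu> t) (at t)"
    using assms(1) DERIV_deriv_iff_real_differentiable has_real_derivative_iff_has_vector_derivative
    by blast
  then have "(radial_covariance \<nu> has_vector_derivative deriv \<nu> t *\<^sub>R mat 1) (at t)"
    unfolding radial_covariance_def
    by (rule bounded_linear.has_vector_derivative[OF bounded_linear_scaleR_left])
  then have "vector_derivative (radial_covariance \<nu>) (at t) = deriv \<nu> t *\<^sub>R mat 1"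
    by (rule vector_derivative_at)
  then show ?thesis
    using assms(2) by (simp add: bw_kinetic_def radial_covariance_def bw_metric_scalar)
qed

text \<open>The function \<open>f x + v * x\<close> has nonnegative derivative, so its value at
  \<open>t\<close> is at most its left limit at \<open>T\<close>. The value \<open>f T\<close> is
  not constrained, hence the passage through \<open>at_left T\<close>.\<close>

lemma limit_plus_rate_bound:
  fixes f :: "real \<Rightarrow> real"
  assumes t: "t \<in> {s<..<T}"
    and lim: "(f \<longlongrightarrow> l) (at_left T)"
    and diff: "\<And>x. x \<in> {s<..<T} \<Longrightarrow> f differentiable at x"
    and rate: "\<And>x. x \<in> {s<..<T} \<Longrightarrow> - deriv f x \<le> v"
  shows "f t \<le> l + v * (T - t)"
proof -
  have "f t + v * t \<le> f u + v * u" if u: "u \<in> {t<..<T}" for u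
  proof (rule DERIV_nonneg_imp_nondecreasing[where f = "\<lambda>x. f x + v * x"])
    fix x assume x: "t \<le> x" "x \<le> u"
    then have "x \<in> {s<..<T}"
      using t u by auto
    then have "((\<lambda>x. f x + v * x) has_real_derivative (deriv f x + v)) (at x)"
      by (auto intro!: derivative_eq_intros DERIV_deriv_iff_real_differentiable[THEN iffD2] diff)
    moreover have "0 \<le> deriv f x + v"
      using rate[of x] \<open>x \<in> _\<close> by simp
    ultimately show "\<exists>y. ((\<lambda>x. f x + v * x) has_real_derivative y) (at x) \<and> 0 \<le> y"
      by blast
  qed (use u in auto)
  then have "\<forall>\<^sub>F u in at_left T. f t + v * t \<le> f u + v * u"
    using t eventually_at_left[of t T] by auto
  moreover have "((\<lambda>u. f u + v * u) \<longlongrightarrow> l + v * T) (at_left T)"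
    by (intro tendsto_intros lim)
  ultimately have "f t + v * t \<le> l + v * T"
    by (intro tendsto_lowerbound[where F = "at_left T"]) (auto simp: trivial_limit_at_left_real)
  then show ?thesis
    by (simp add: algebra_simps)
qed

lemma nn_integral_inverse_distance_infinite:
  fixes s T C :: real
  assumes "s < T" and "C > 0"
  shows "(\<integral>\<^sup>+ t\<in>{s<..<T}. ennreal (C / (T - t)) \<partial>lborel) = \<infinity>"
proof -
  \<comment> \<open>The closed intervals \<open>{m..u}\<close> needed for the fundamental theorem
    must lie inside the open segment, so they start at an interior point.\<close>
  define m where "m = (s + T) / 2"
  have m: "s < m" "m < T"
    using assms(1) by (auto simp: m_def)
  let ?I = "\<integral>\<^sup>+ t\<in>{s<..<T}. ennreal (C / (T - t)) \<partial>lborel"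
  have le: "ennreal (C * ln (T - m) - C * ln (T - u)) \<le> ?I" if u: "u \<in> {m<..<T}" for u
  proof -
    have "(\<integral>\<^sup>+ t. ennreal (C / (T - t)) * indicator {m..u} t \<partial>lborel) =
        ennreal (- C * ln (T - u) - - C * ln (T - m))"
    proof (rule nn_integral_FTC_Icc)
      show "((\<lambda>t. - C * ln (T - t)) has_real_derivative C / (T - t)) (at t)"
        if "t \<in> {m..u}" for t
        using that u by (auto intro!: derivative_eq_intros simp: field_simps)
    qed (use u assms in auto)
    moreover have "(\<integral>\<^sup>+ t. ennreal (C / (T - t)) * indicator {m..u} t \<partial>lborel) \<le> ?I"
      using m u by (intro nn_integral_mono) (auto simp: indicator_def)
    ultimately show ?thesis
      by (simp add: algebra_simps)
  qed
  show ?thesis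
  proof (rule ccontr)
    assume "?I \<noteq> \<infinity>"
    then obtain r where r: "?I = ennreal r" "r \<ge> 0"
      by (cases ?I) auto
    \<comment> \<open>The primitive \<open>- C * ln (T - u)\<close> blows up at \<open>T\<close>, so
      the integrals over \<open>{m..u}\<close> eventually exceed any supposed finite value
      \<open>r\<close>.\<close>
    have "filterlim (\<lambda>u. C * ln (T - m) - C * ln (T - u)) at_top (at_left T)"
      using assms(2) by real_asymp
    then have "\<forall>\<^sub>F u in at_left T. r < C * ln (T - m) - C * ln (T - u)"
      by (simp add: filterlim_at_top_dense)
    moreover have "\<forall>\<^sub>F u in at_left T. u \<in> {m<..<T}"
      using m(2) by (rule eventually_at_left_real)
    ultimately have "\<forall>\<^sub>F u in at_left T. False"
    proof eventually_elim
      case (elim u)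
      then show False
        using le[of u] r by (simp add: ennreal_le_iff)
    qed
    then show False
      by (simp add: trivial_limit_at_left_real eventually_False)
  qed
qed

text \<open>Integrals are taken in \<open>ennreal\<close>, where divergence is the value
  \<open>\<infinity>\<close>. Both densities are nonnegative for \<nu> > 1/2, so
  \<open>ennreal\<close> truncates nothing. Every final segment obeying the rate bounds is covered
  by letting \<open>s\<close> vary.\<close>

theorem proposition20:
  fixes \<nu> :: "real \<Rightarrow> real" and a T v\<^sub>0 v\<^sub>1 :: real
  assumes "a < T"
    and "\<nu> C1_differentiable_on {a<..<T}"
    and "\<forall>t\<in>{a<..<T}. \<nu> t > 1 / 2"
    and "filterlim \<nu> (at_right (1 / 2)) (at_left T)"
    and "0 < v\<^sub>0"
    and "\<forall>\<^sub>F t in at_left T. v\<^sub>0 \<le> - deriv \<nu> t \<and> - deriv \<nu> t \<le> v\<^sub>1"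
  shows "(\<forall>t\<in>{a<..<T}. bures_kinetic \<nu> t = (deriv \<nu> t)\<^sup>2 / (4 * ((\<nu> t)\<^sup>2 - 1 / 4))) \<and>
    filterlim (bures_kinetic \<nu>) at_top (at_left T) \<and>
    (\<forall>t\<in>{a<..<T}. bw_kinetic (radial_covariance \<nu>) t = (deriv \<nu> t)\<^sup>2 / (2 * \<nu> t)) \<and>
    (\<forall>s\<in>{a..<T}. (\<forall>t\<in>{s<..<T}. v\<^sub>0 \<le> - deriv \<nu> t \<and> - deriv \<nu> t \<le> v\<^sub>1) \<longrightarrow>
       bounded (bw_kinetic (radial_covariance \<nu>) ` {s<..<T}) \<and>
       (\<integral>\<^sup>+ t\<in>{s<..<T}. ennreal (bures_kinetic \<nu> t) \<partial>lborel) = \<infinity> \<and>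
       (\<integral>\<^sup>+ t\<in>{s<..<T}. ennreal (bw_kinetic (radial_covariance \<nu>) t) \<partial>lborel) < \<infinity>)"
proof (intro conjI ballI impI)
  have diff: "\<nu> differentiable at t" if "t \<in> {a<..<T}" for t
    using assms(2) that C1_differentiable_on_eq by blast
  have pos: "\<nu> t > 1 / 2" if "t \<in> {a<..<T}" for t
    using assms(3) that by blast
  have lim: "(\<nu> \<longlongrightarrow> 1 / 2) (at_left T)"
    using assms(4) by (simp add: filterlim_at)
  have B: "bures_kinetic \<nu> t = (deriv \<nu> t)\<^sup>2 / (4 * ((\<nu> t)\<^sup>2 - 1 / 4))" for t
    by (simp add: bures_kinetic_def bures_radial_coeff_def)
  have BW: "bw_kinetic (radial_covariance \<nu>) t = (deriv \<nu> t)\<^sup>2 / (2 * \<nu> t)"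
    if "t \<in> {a<..<T}" for t
    using pos[OF that] by (intro bw_kinetic_radial diff that) auto
  have sq: "(\<nu> t)\<^sup>2 - 1 / 4 = (\<nu> t - 1 / 2) * (\<nu> t + 1 / 2)" for t
    by (simp add: power2_eq_square algebra_simps)
  show "bures_kinetic \<nu> t = (deriv \<nu> t)\<^sup>2 / (4 * ((\<nu> t)\<^sup>2 - 1 / 4))" for t
    by (fact B)
  show "bw_kinetic (radial_covariance \<nu>) t = (deriv \<nu> t)\<^sup>2 / (2 * \<nu> t)"
    if "t \<in> {a<..<T}" for t
    by (fact BW[OF that])
  have inside: "\<forall>\<^sub>F t in at_left T. t \<in> {a<..<T}"
    using assms(1) by (rule eventually_at_left_real)
  show "filterlim (bures_kinetic \<nu>) at_top (at_left T)"
  proof (rule filterlim_at_top_mono)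
    \<comment> \<open>In this minorant the squared rate is replaced by its lower bound; the
      denominator tends to 0 through positive values.\<close>
    show "filterlim (\<lambda>t. v\<^sub>0\<^sup>2 / (4 * ((\<nu> t)\<^sup>2 - 1 / 4))) at_top (at_left T)"
    proof (rule LIM_at_top_divide[OF tendsto_const])
      show "((\<lambda>t. 4 * ((\<nu> t)\<^sup>2 - 1 / 4)) \<longlongrightarrow> 0) (at_left T)"
        by (auto intro!: tendsto_eq_intros lim simp: power2_eq_square)
      show "\<forall>\<^sub>F t in at_left T. 0 < 4 * ((\<nu> t)\<^sup>2 - 1 / 4)"
        using inside
      proof eventually_elim
        case (elim t)
        then show ?case
          using pos[OF elim] by (simp add: sq)
      qed
    qed (use assms(5) in auto)
    show "\<forall>\<^sub>F t in at_left T. v\<^sub>0\<^sup>2 / (4 * ((\<nu> t)\<^sup>2 - 1 / 4)) \<le> bures_kinetic \<nu> t"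
      using inside assms(6)
    proof eventually_elim
      case (elim t)
      have "v\<^sub>0\<^sup>2 \<le> (- deriv \<nu> t)\<^sup>2"
        using elim assms(5) by (intro power_mono) auto
      moreover have "(\<nu> t)\<^sup>2 - 1 / 4 > 0"
        using pos[OF elim(1)] by (simp add: sq)
      ultimately show ?case
        by (simp add: B divide_right_mono)
    qed
  qed
  fix s
  assume s: "s \<in> {a..<T}"
    and rate: "\<forall>t\<in>{s<..<T}. v\<^sub>0 \<le> - deriv \<nu> t \<and> - deriv \<nu> t \<le> v\<^sub>1"
  have sub: "t \<in> {a<..<T}" if "t \<in> {s<..<T}" for t
    using s that by auto
  \<comment> \<open>The segment is nonempty, so some point witnesses
    \<open>v\<^sub>0 \<le> v\<^sub>1\<close>, which makes \<open>v\<^sub>1\<close> positive.\<close>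
  have "(s + T) / 2 \<in> {s<..<T}"
    using s by auto
  then have v1: "v\<^sub>1 > 0"
    using rate assms(5) by fastforce
  have bw_bound: "0 \<le> bw_kinetic (radial_covariance \<nu>) t \<and>
      bw_kinetic (radial_covariance \<nu>) t \<le> v\<^sub>1\<^sup>2" if t: "t \<in> {s<..<T}" for t
  proof -
    have "(- deriv \<nu> t)\<^sup>2 \<le> v\<^sub>1\<^sup>2"
      using rate t assms(5) by (intro power_mono) force+
    \<comment> \<open>The denominator \<open>2 * \<nu> t\<close> exceeds 1, its value at the
      boundary.\<close>
    then have "(deriv \<nu> t)\<^sup>2 / (2 * \<nu> t) \<le> v\<^sub>1\<^sup>2 / 1"
      using pos[OF sub[OF t]] by (intro frac_le) auto
    then show ?thesis
      using pos[OF sub[OF t]] by (simp add: BW[OF sub[OF t]])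
  qed
  show "bounded (bw_kinetic (radial_covariance \<nu>) ` {s<..<T})"
    using bw_bound by (intro boundedI[where B = "v\<^sub>1\<^sup>2"]) auto
  \<comment> \<open>A constant majorant on an interval of finite length has finite integral.\<close>
  have "(\<integral>\<^sup>+ t\<in>{s<..<T}. ennreal (bw_kinetic (radial_covariance \<nu>) t) \<partial>lborel)
      \<le> (\<integral>\<^sup>+ t. ennreal (v\<^sub>1\<^sup>2) * indicator {s<..<T} t \<partial>lborel)"
    using bw_bound by (intro nn_integral_mono) (auto simp: indicator_def intro!: ennreal_leI)
  also have "\<dots> < \<infinity>"
    using s by (simp add: nn_integral_cmult_indicator ennreal_mult_less_top)
  finally show "(\<integral>\<^sup>+ t\<in>{s<..<T}. ennreal (bw_kinetic (radial_covariance \<nu>) t) \<partial>lborel) < \<infinity>" .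
  \<comment> \<open>The constant collects the lower bound \<open>v\<^sub>0\<^sup>2\<close> of the
    numerator, the factor 4 of the coefficient, the slope \<open>v\<^sub>1\<close> of the bound on
    \<nu> - 1/2, and the uniform bound \<open>1 + v\<^sub>1 * (T - s)\<close> on \<nu> +
    1/2.\<close>
  define C where "C = v\<^sub>0\<^sup>2 / (4 * v\<^sub>1 * (1 + v\<^sub>1 * (T - s)))"
  have pos_C: "1 + v\<^sub>1 * (T - s) > 0"
    using s v1 by (intro add_pos_nonneg mult_nonneg_nonneg) auto
  then have "C > 0"
    using assms(5) v1 by (simp add: C_def)
  have bures_bound: "C / (T - t) \<le> bures_kinetic \<nu> t" if t: "t \<in> {s<..<T}" for t
  proof -
    \<comment> \<open>This estimate serves twice: as it stands it bounds the vanishing factor \<nu>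
      - 1/2, and with \<open>T - t\<close> enlarged to \<open>T - s\<close> it bounds \<nu> +
      1/2.\<close>
    have gap: "\<nu> t \<le> 1 / 2 + v\<^sub>1 * (T - t)"
      using rate by (intro limit_plus_rate_bound[OF t lim] diff sub) auto
    also have "\<dots> \<le> 1 / 2 + v\<^sub>1 * (T - s)"
      using t v1 by simp
    finally have "(\<nu> t)\<^sup>2 - 1 / 4 \<le> (v\<^sub>1 * (T - t)) * (1 + v\<^sub>1 * (T - s))"
      unfolding sq using gap t v1 pos[OF sub[OF t]] by (intro mult_mono) auto
    moreover have "(\<nu> t)\<^sup>2 - 1 / 4 > 0"
      using pos[OF sub[OF t]] by (simp add: sq)
    moreover have "v\<^sub>0\<^sup>2 \<le> (- deriv \<nu> t)\<^sup>2"
      using rate t assms(5) by (intro power_mono) auto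
    ultimately have "v\<^sub>0\<^sup>2 / (4 * ((v\<^sub>1 * (T - t)) * (1 + v\<^sub>1 * (T - s)))) \<le> bures_kinetic \<nu> t"
      unfolding B by (intro frac_le) auto
    then show ?thesis
      by (simp add: C_def mult_ac)
  qed
  have "(\<integral>\<^sup>+ t\<in>{s<..<T}. ennreal (C / (T - t)) \<partial>lborel)
      \<le> (\<integral>\<^sup>+ t\<in>{s<..<T}. ennreal (bures_kinetic \<nu> t) \<partial>lborel)"
    using bures_bound by (intro nn_integral_mono) (auto simp: indicator_def intro!: ennreal_leI)
  then show "(\<integral>\<^sup>+ t\<in>{s<..<T}. ennreal (bures_kinetic \<nu> t) \<partial>lborel) = \<infinity>"
    using nn_integral_inverse_distance_infinite[of s T C] s \<open>C > 0\<close> by (simp add: top_unique)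
qed

end
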